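(* Let $\ell \ge 2$ and $r := 2^{\ell-1}+1$. There exists a constant $C_\ell>0$ such that for every $n\ge 2$ there exists an $r$-prover game $\mathcal{G}$ with question set $\overline{Q}_r$, with $\mathrm{val}(\mathcal{G})\le 1-1/r$, and with answer set $\overline{A}$ of size $|\overline{A}|\in[2^{rn},2^{2rn}]$, such that $$\mathrm{val}(\mathcal{G}^n) \ge \exp\left(-C_\ell\, n\cdot \frac{(\log\log|\overline{A}|)^{1/\ell}}{\log|\overline{A}|}\right).$$
   Context: $\log$ denotes the base-2 logarithm. Games: an $r$-prover question set is a finite nonempty $\overline{Q}\subseteq Q^{(1)}\times\cdots\times Q^{(r)}$ with finite $Q^{(j)}$ such that every element of each $Q^{(j)}$ occurs as a $j$-th coordinate of some tuple of $\overline{Q}$. An $r$-prover game with question set $\overline{Q}$ is $(\overline{Q},\overline{A},V)$ with answer set $\overline{A}=A^{(1)}\times\cdots\times A^{(r)}$ a product of finite alphabets and $V:\overline{Q}\times\overline{A}\to\{0,1\}$. A strategy is $(\mathcal{S}^{(1)},\dots,\mathcal{S}^{(r)})$, $\mathcal{S}^{(j)}:Q^{(j)}\to A^{(j)}$; the value is the maximum over strategies of the probability, over $\overline{q}$ uniform on $\overline{Q}$, that $V(\overline{q},\mathcal{S}^{(1)}(q^{(1)}),\dots,\mathcal{S}^{(r)}(q^{(r)}))=1$. The $n$-fold parallel repetition $\mathcal{G}^n$ has question set $\overline{Q}^n$ (prover $j$ gets the $n$ $j$-th coordinates), answer alphabets $(A^{(j)})^n$, and accepts iff $V$ accepts in all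 $n$ coordinates. $\overline{Q}_r$: $Q^{(j)}=\{0,1\}$ for all $j$, and $\overline{Q}_r=\{(q^{(1)},\dots,q^{(r)})\in\{0,1\}^r: \text{exactly one } q^{(j)} \text{ equals } 1\}$. *)

theory Defs
  imports Complex_Main "HOL-Library.FuncSet"
begin

(* Provers are numbered 0, ..., r - 1.  An r-tuple is an extensional function on {..<r} and an
   n-fold sequence is an extensional function on {..<n}, so that all the products below are
   finite sets with the intended cardinality. *)

definition is_question_set :: "nat \<Rightarrow> (nat \<Rightarrow> 'q set) \<Rightarrow> (nat \<Rightarrow> 'q) set \<Rightarrow> bool" where
  "is_question_set r Qs Q \<longleftrightarrow>
     (\<forall>j<r. finite (Qs j)) \<and> Q \<noteq> {} \<and> Q \<subseteq> (\<Pi>\<^sub>E j\<in>{..<r}. Qs j) \<and>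
     (\<forall>j<r. \<forall>x\<in>Qs j. \<exists>q\<in>Q. q j = x)"

record ('q, 'a) game =
  provers :: nat
  question_alphabet :: "nat \<Rightarrow> 'q set"
  question_set :: "(nat \<Rightarrow> 'q) set"
  answer_alphabet :: "nat \<Rightarrow> 'a set"
  verifier :: "(nat \<Rightarrow> 'q) \<Rightarrow> (nat \<Rightarrow> 'a) \<Rightarrow> bool"

definition answer_set :: "('q, 'a) game \<Rightarrow> (nat \<Rightarrow> 'a) set" where
  "answer_set G = (\<Pi>\<^sub>E j\<in>{..<provers G}. answer_alphabet G j)"

(* Nonemptiness of the answer alphabets guarantees that there is a strategy, so that the
   maximum in the definition of the value exists. *)
definition is_game :: "('q, 'a) game \<Rightarrow> bool" where
  "is_game G \<longleftrightarrow>
     is_question_set (provers G) (question_alphabet G) (question_set G) \<and>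
     (\<forall>j<provers G. finite (answer_alphabet G j) \<and> answer_alphabet G j \<noteq> {})"

definition strategies :: "('q, 'a) game \<Rightarrow> (nat \<Rightarrow> 'q \<Rightarrow> 'a) set" where
  "strategies G = (\<Pi>\<^sub>E j\<in>{..<provers G}. question_alphabet G j \<rightarrow>\<^sub>E answer_alphabet G j)"

definition success_prob :: "('q, 'a) game \<Rightarrow> (nat \<Rightarrow> 'q \<Rightarrow> 'a) \<Rightarrow> real" where
  "success_prob G S =
     real (card {q \<in> question_set G. verifier G q (\<lambda>j\<in>{..<provers G}. S j (q j))}) /
     real (card (question_set G))"

definition game_value :: "('q, 'a) game \<Rightarrow> real" where
  "game_value G = Max (success_prob G ` strategies G)"

(* In the n-fold repetition prover j receives (and returns) a sequence, so x j i is the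
   entry of prover j in coordinate i; coord r x i is the r-tuple of the i-th copy of the game. *)
definition coord :: "nat \<Rightarrow> (nat \<Rightarrow> nat \<Rightarrow> 'b) \<Rightarrow> nat \<Rightarrow> (nat \<Rightarrow> 'b)" where
  "coord r x i = (\<lambda>j\<in>{..<r}. x j i)"

definition parallel_repetition ::
    "nat \<Rightarrow> ('q, 'a) game \<Rightarrow> (nat \<Rightarrow> 'q, nat \<Rightarrow> 'a) game" where
  "parallel_repetition n G =
     \<lparr> provers = provers G,
       question_alphabet = (\<lambda>j. {..<n} \<rightarrow>\<^sub>E question_alphabet G j),
       question_set =
         {q \<in> (\<Pi>\<^sub>E j\<in>{..<provers G}. {..<n} \<rightarrow>\<^sub>E question_alphabet G j).
            \<forall>i<n. coord (provers G) q i \<in> question_set G},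
       answer_alphabet = (\<lambda>j. {..<n} \<rightarrow>\<^sub>E answer_alphabet G j),
       verifier = (\<lambda>q a. \<forall>i<n. verifier G (coord (provers G) q i) (coord (provers G) a i)) \<rparr>"

definition one_hot_questions :: "nat \<Rightarrow> (nat \<Rightarrow> nat) set" where
  "one_hot_questions r = {q \<in> {..<r} \<rightarrow>\<^sub>E {0, 1}. \<exists>!j. j < r \<and> q j = 1}"

end

theory Submission
  imports Defs "HOL-Computational_Algebra.Polynomial"
begin

text \<open>The single-round verifier asks every prover for a complete input to the \<open>n\<close>-fold game and for
  the coordinate in which its question is placed, and accepts if these inputs form a point of a
  fixed set \<open>W \<subseteq> {..<r} ^ n\<close>. Answering honestly in all \<open>n\<close> coordinates wins the repeated game on all
  of \<open>W\<close>, whereas a strategy winning on all \<open>r\<close> questions of a single round is a combinatorial line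
  in \<open>W\<close>. Choosing for \<open>W\<close> the points whose coordinate sum lies in a translate of a set without
  \<open>r\<close>-term arithmetic progressions excludes lines, and averaging over translates makes \<open>W\<close> about as
  dense as that set. The density comes from Rankin's construction, by induction on \<open>l\<close> over sets
  without progressions along polynomials of degree \<open>D\<close>: take the integers with small digits whose
  sum of squared digits lies in a translate of a set without progressions of degree \<open>2 * D\<close>. A
  non-constant progression there would make the sum of squares constant, which is impossible as
  its leading coefficient is a sum of squares.\<close>

section \<open>Finite differences\<close>

text \<open>Iterated forward difference, over any commutative ring so that integer digits and real
  polynomial values are treated alike.\<close>

primrec fdiff :: "nat \<Rightarrow> (nat \<Rightarrow> 'a::comm_ring_1) \<Rightarrow> nat \<Rightarrow> 'a" where
  "fdiff 0 w i = w i"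
| "fdiff (Suc n) w i = fdiff n w (Suc i) - fdiff n w i"

lemma fdiff_cong:
  assumes "\<And>s. i \<le> s \<Longrightarrow> s \<le> i + n \<Longrightarrow> v s = w s"
  shows "fdiff n v i = fdiff n w i"
  using assms
proof (induction n arbitrary: i)
  case (Suc n)
  have "fdiff n v (Suc i) = fdiff n w (Suc i)" "fdiff n v i = fdiff n w i"
    by (rule Suc.IH, simp add: Suc.prems)+
  then show ?case by simp
qed simp

text \<open>Moves the first difference inside, so that an induction on the order can replace a
  sequence by its difference sequence.\<close>

lemma fdiff_Suc_shift: "fdiff (Suc n) w i = fdiff n (\<lambda>s. w (Suc s) - w s) i"
  by (induction n arbitrary: i) simp_all

lemma fdiff_diff: "fdiff n (\<lambda>s. v s - w s) i = fdiff n v i - fdiff n w i"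
  by (induction n arbitrary: i) simp_all

lemma fdiff_sum_scaled:
  "fdiff n (\<lambda>s. \<Sum>j\<in>J. w j s * b j) i = (\<Sum>j\<in>J. fdiff n (w j) i * b j)"
  by (induction n arbitrary: i) (simp_all add: sum_subtractf left_diff_distrib)

lemma of_int_fdiff: "of_int (fdiff n w i) = fdiff n (\<lambda>s. of_int (w s)) i"
  by (induction n arbitrary: i) simp_all

lemma abs_fdiff_le:
  fixes w :: "nat \<Rightarrow> int"
  assumes "\<And>s. i \<le> s \<Longrightarrow> s \<le> i + n \<Longrightarrow> \<bar>w s\<bar> \<le> K"
  shows "\<bar>fdiff n w i\<bar> \<le> 2 ^ n * K"
  using assms
proof (induction n arbitrary: i)
  case (Suc n)
  have "\<bar>fdiff n w (Suc i)\<bar> \<le> 2 ^ n * K" "\<bar>fdiff n w i\<bar> \<le> 2 ^ n * K"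
    using Suc.prems by (auto intro!: Suc.IH)
  then show ?case by simp
qed simp

text \<open>The last term enters a forward difference with coefficient 1, and here it is the only
  one left.\<close>

lemma fdiff_eq_last:
  assumes "\<And>s. i \<le> s \<Longrightarrow> s < i + n \<Longrightarrow> w s = 0"
  shows "fdiff n w i = w (i + n)"
  using assms
proof (induction n arbitrary: i)
  case (Suc n)
  have "fdiff n w (Suc i) = w (Suc i + n)" "fdiff n w i = w (i + n)"
    by (rule Suc.IH, simp add: Suc.prems)+
  moreover have "w (i + n) = 0" using Suc.prems by simp
  ultimately show ?case by simp
qed simp

text \<open>Subtracting \<open>p\<close> from its shift by 1 cancels the leading terms, so every
  difference lowers the degree; constants go to 0.\<close>

lemma fdiff_poly_eq_0:
  fixes p :: "real poly"
  assumes "p = 0 \<or> degree p < n"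
  shows "fdiff n (\<lambda>s. poly p (of_nat s)) i = 0"
  using assms
proof (induction n arbitrary: p i)
  case (Suc n)
  define q where "q = pcompose p [:1, 1:] - p"
  have "q = 0 \<or> degree q < n"
  proof (cases "degree p = 0")
    case True
    then obtain c where "p = [:c:]" by (metis degree_eq_zeroE)
    then show ?thesis by (simp add: q_def)
  next
    case False
    have d: "degree (pcompose p [:1, 1:]) = degree p" by (simp add: degree_pcompose)
    have "coeff q (degree p) = 0"
      using lead_coeff_comp[of "[:1, 1::real:]" p] d by (simp add: q_def)
    moreover have "degree q \<le> degree p"
      unfolding q_def using d by (intro degree_diff_le) auto
    ultimately have "q = 0 \<or> degree q < degree p"
      by (metis eq_zero_or_degree_less)
    then show ?thesis using Suc.prems False by auto
  qed
  then have "fdiff n (\<lambda>s. poly q (of_nat s)) i = 0" by (rule Suc.IH)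
  then show ?case
    by (subst fdiff_Suc_shift) (simp add: q_def poly_pcompose add.commute)
qed simp

text \<open>Newton interpolation: the value at the new node is corrected by a multiple of
  \<open>g\<close>, which vanishes at all earlier nodes.\<close>

lemma poly_interpolation_exists:
  fixes w :: "nat \<Rightarrow> real"
  shows "\<exists>p. degree p \<le> D \<and> (\<forall>s\<le>D. poly p (of_nat s) = w s)"
proof (induction D)
  case 0
  show ?case by (intro exI[of _ "[:w 0:]"]) simp
next
  case (Suc D)
  then obtain p where p: "degree p \<le> D" "\<And>s. s \<le> D \<Longrightarrow> poly p (of_nat s) = w s" by blast
  define g :: "real poly" where "g = (\<Prod>s\<le>D. [:- of_nat s, 1:])"
  have g: "poly g x = (\<Prod>s\<le>D. x - of_nat s)" for x by (simp add: g_def poly_prod)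
  have dg: "degree g = Suc D" by (simp add: g_def degree_prod_eq_sum_degree)
  have g1: "poly g (of_nat (Suc D)) \<noteq> 0" unfolding g by (auto simp del: of_nat_Suc)
  define c where "c = (w (Suc D) - poly p (of_nat (Suc D))) / poly g (of_nat (Suc D))"
  have "poly (p + smult c g) (of_nat s) = w s" if "s \<le> Suc D" for s
  proof (cases "s = Suc D")
    case True
    then show ?thesis using g1 by (simp add: c_def del: of_nat_Suc)
  next
    case False
    then have "s \<le> D" using that by simp
    moreover from this have "poly g (of_nat s) = 0" unfolding g by (auto intro!: prod_zero)
    ultimately show ?thesis using p(2) by simp
  qed
  moreover have "degree (p + smult c g) \<le> Suc D"
    using p(1) dg by (intro degree_add_le) auto
  ultimately show ?case by blast
qed

text \<open>Interpolate the first \<open>D + 1\<close> values. The error has vanishing differences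
  of order \<open>Suc D\<close>, so each later error is determined by its \<open>D + 1\<close>
  predecessors, which are 0 by induction.\<close>

lemma poly_of_fdiff_eq_0:
  fixes w :: "nat \<Rightarrow> real"
  assumes "\<And>i. i + Suc D < k \<Longrightarrow> fdiff (Suc D) w i = 0"
  shows "\<exists>p. degree p \<le> D \<and> (\<forall>s<k. poly p (of_nat s) = w s)"
proof -
  obtain p where p: "degree p \<le> D" "\<And>s. s \<le> D \<Longrightarrow> poly p (of_nat s) = w s"
    using poly_interpolation_exists by blast
  have "poly p (of_nat s) - w s = 0" if "s < k" for s
    using that
  proof (induction s rule: less_induct)
    case (less s)
    show ?case
    proof (cases "s \<le> D")
      case False
      then obtain i where s: "s = i + Suc D" by (metis add.commute le_Suc_ex not_less_eq_eq)
      let ?v = "\<lambda>s. poly p (of_nat s) - w s"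
      have "?v (i + Suc D) = fdiff (Suc D) ?v i"
        using less by (intro fdiff_eq_last[symmetric]) (simp add: s)
      also have "\<dots> = 0"
        unfolding fdiff_diff using fdiff_poly_eq_0[of p "Suc D" i] assms[of i] p(1) less.prems
        by (simp add: s del: fdiff.simps)
      finally show ?thesis by (simp add: s)
    qed (use p(2) in simp)
  qed
  then show ?thesis using p(1) by auto
qed

section \<open>Sets without polynomial progressions\<close>

text \<open>For \<open>D = 1\<close> this excludes non-constant \<open>k\<close>-term arithmetic
  progressions; higher \<open>D\<close> serves the induction, where squaring doubles degrees.
  Coefficients are real because interpolation through integers need not give integer ones.\<close>

definition prog_free :: "nat \<Rightarrow> nat \<Rightarrow> int set \<Rightarrow> bool" where
  "prog_free k D A \<longleftrightarrow>
     (\<forall>p :: real poly. degree p \<le> D \<longrightarrow> (\<forall>i<k. \<exists>a\<in>A. poly p (of_nat i) = of_int a) \<longrightarrow> degree p = 0)"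

text \<open>Otherwise \<open>p - [:c:]\<close> would have more roots than its degree allows.\<close>

lemma degree_eq_0_if_constant_on:
  fixes p :: "real poly"
  assumes "degree p < k" and "\<And>i. i < k \<Longrightarrow> poly p (of_nat i) = c"
  shows "degree p = 0"
proof -
  have "p - [:c:] = 0"
  proof (rule ccontr)
    assume nz: "p - [:c:] \<noteq> 0"
    have "k = card (of_nat ` {..<k} :: real set)" by (simp add: card_image)
    also have "\<dots> \<le> card {x. poly (p - [:c:]) x = 0}"
      using assms(2) by (intro card_mono poly_roots_finite nz) auto
    also have "\<dots> \<le> degree (p - [:c:])" by (rule card_poly_roots_bound[OF nz])
    also have "\<dots> \<le> degree p" by (intro degree_diff_le) auto
    finally show False using assms(1) by simp
  qed
  then show ?thesis by (metis degree_pCons_0 right_minus_eq)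
qed

lemma prog_free_singleton: "D < k \<Longrightarrow> prog_free k D {a}"
  unfolding prog_free_def by (auto intro: degree_eq_0_if_constant_on)

lemma prog_freeD:
  fixes p :: "real poly"
  assumes "prog_free k D A" and "degree p \<le> D"
    and "\<And>i. i < k \<Longrightarrow> \<exists>a\<in>A. poly p (of_nat i) = of_int a"
  shows "degree p = 0"
  using assms unfolding prog_free_def by blast

lemma prog_free_translate:
  assumes "prog_free k D A"
  shows "prog_free k D {a. a + t \<in> A}"
  unfolding prog_free_def
proof (intro allI impI)
  fix p :: "real poly"
  assume dp: "degree p \<le> D"
    and ex: "\<forall>i<k. \<exists>a\<in>{a. a + t \<in> A}. poly p (of_nat i) = of_int a"
  have "degree (p + [:of_int t:]) = 0"
  proof (rule prog_freeD[OF assms])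
    show "degree (p + [:of_int t:]) \<le> D" using dp by (intro degree_add_le) auto
    fix i
    assume "i < k"
    then obtain a where "a + t \<in> A" "poly p (of_nat i) = of_int a" using ex by auto
    then show "\<exists>a\<in>A. poly (p + [:of_int t:]) (of_nat i) = of_int a"
      by (intro bexI[of _ "a + t"]) auto
  qed
  moreover have "p = (p + [:of_int t:]) - [:of_int t:]" by simp
  ultimately show "degree p = 0" by (metis degree_diff_le degree_pCons_0 le_zero_eq order_refl)
qed

text \<open>If the largest degree \<open>e\<close> were positive, the coefficient of the sum at
  \<open>e + e\<close> would be a sum of real squares, not all zero, so no cancellation could lower
  the degree.\<close>

lemma degree_eq_0_if_sum_squares:
  fixes p :: "'i \<Rightarrow> real poly"
  assumes "finite J" and "degree (\<Sum>j\<in>J. p j * p j) = 0" and "j \<in> J"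
  shows "degree (p j) = 0"
proof -
  define e where "e = Max ((\<lambda>j. degree (p j)) ` J)"
  have le: "degree (p i) \<le> e" if "i \<in> J" for i using that assms(1) by (simp add: e_def)
  have c: "coeff (p i * p i) (e + e) = (coeff (p i) e)\<^sup>2" if "i \<in> J" for i
  proof (cases "degree (p i) = e")
    case True
    then show ?thesis using coeff_mult_degree_sum[of "p i" "p i"] by (simp add: power2_eq_square)
  next
    case False
    then have lt: "degree (p i) < e" using le[OF that] by simp
    then have "degree (p i * p i) < e + e" using degree_mult_le[of "p i" "p i"] by linarith
    then show ?thesis using lt by (simp add: coeff_eq_0)
  qed
  have "e = 0"
  proof (rule ccontr)
    assume e: "e \<noteq> 0"
    have "(\<Sum>i\<in>J. (coeff (p i) e)\<^sup>2) = coeff (\<Sum>j\<in>J. p j * p j) (e + e)"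
      by (simp add: coeff_sum c)
    also have "\<dots> = 0" using assms(2) e by (intro coeff_eq_0) simp
    finally have z: "coeff (p i) e = 0" if "i \<in> J" for i
      using that assms(1) by (simp add: sum_nonneg_eq_0_iff)
    have "e \<in> (\<lambda>j. degree (p j)) ` J" unfolding e_def using assms(1,3) by (intro Max_in) auto
    then obtain i where i: "i \<in> J" "degree (p i) = e" by auto
    with z[OF i(1)] have "p i = 0" by (metis leading_coeff_0_iff)
    then show False using i e by simp
  qed
  then show ?thesis using le[OF assms(3)] by simp
qed

section \<open>Digit expansions and averaging over translates\<close>

text \<open>Modulo \<open>B\<close> only \<open>c 0\<close> survives; it is divisible by
  \<open>B\<close> and smaller in absolute value, hence 0. Dividing by \<open>B\<close> leaves a
  shorter expansion. Negative digits are allowed, so that differences of digits are covered.\<close>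

lemma digits_eq_0:
  fixes c :: "nat \<Rightarrow> int"
  assumes "(\<Sum>j<m. c j * B ^ j) = 0" and "\<And>j. j < m \<Longrightarrow> \<bar>c j\<bar> < B" and "j < m"
  shows "c j = 0"
  using assms
proof (induction m arbitrary: c j)
  case (Suc m)
  have B: "B > 0" using Suc.prems(2)[of 0] by auto
  have eq: "c 0 + B * (\<Sum>j<m. c (Suc j) * B ^ j) = 0"
    using Suc.prems(1) by (simp add: sum.lessThan_Suc_shift sum_distrib_left mult_ac del: sum.lessThan_Suc)
  then have "B dvd c 0" by (metis add.commute add_0 diff_add_cancel dvd_minus_iff dvd_triv_left eq_neg_iff_add_eq_0)
  then have c0: "c 0 = 0" using Suc.prems(2)[of 0] dvd_imp_le_int[of "c 0" B] B by force
  then have s: "(\<Sum>j<m. c (Suc j) * B ^ j) = 0" using eq B by simp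
  show ?case
  proof (cases j)
    case (Suc i)
    then show ?thesis using Suc.IH[of "\<lambda>j. c (Suc j)" i, OF s] Suc.prems by auto
  qed (use c0 in simp)
qed simp

lemma digits_less:
  fixes x :: "nat \<Rightarrow> int"
  assumes "\<And>j. j < m \<Longrightarrow> 0 \<le> x j \<and> x j < B"
  shows "(\<Sum>j<m. x j * B ^ j) < B ^ m"
  using assms
proof (induction m)
  case (Suc m)
  have x: "0 \<le> x m" "x m \<le> B - 1" using Suc.prems[of m] by auto
  then have "x m * B ^ m \<le> (B - 1) * B ^ m" by (intro mult_right_mono) auto
  moreover have "(\<Sum>j<m. x j * B ^ j) < B ^ m" using Suc by simp
  ultimately show ?case by (simp add: algebra_simps)
qed simp

text \<open>Double counting: each \<open>x\<close> is sent into \<open>A\<close> by exactly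
  \<open>card A\<close> of the \<open>2 * N\<close> shifts considered, so some shift does at least
  as well as the average.\<close>

lemma exists_translate_many:
  fixes Y :: "'x \<Rightarrow> int"
  assumes "finite X" and "\<And>x. x \<in> X \<Longrightarrow> 0 \<le> Y x \<and> Y x < int N" and "A \<subseteq> {0..<int N}"
  shows "\<exists>t. card X * card A \<le> card {x \<in> X. Y x + t \<in> A} * (2 * N)"
proof (rule ccontr)
  assume "\<not> ?thesis"
  then have lt: "card {x \<in> X. Y x + t \<in> A} * (2 * N) < card X * card A" for t
    by (simp add: not_le)
  \<comment> \<open>This window contains every difference of two elements of
    \<open>{0..<int N}\<close>, so no shift that matters is lost.\<close>
  let ?T = "{- int N..<int N}"
  have cT: "card ?T = 2 * N" by simp
  have N: "N > 0" using lt[of 0] assms(2) by (cases "X = {}") force+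
  have fA: "finite A" using assms(3) finite_subset by blast
  have c: "card {t \<in> ?T. Y x + t \<in> A} = card A" if "x \<in> X" for x
  proof -
    have "{t \<in> ?T. Y x + t \<in> A} = (\<lambda>a. a - Y x) ` A"
      using assms(2)[OF that] assms(3) by (auto simp: image_iff subset_iff) (smt (verit))+
    then show ?thesis by (simp add: card_image inj_on_def)
  qed
  have "(\<Sum>t\<in>?T. card {x \<in> X. Y x + t \<in> A}) = (\<Sum>x\<in>X. card {t \<in> ?T. Y x + t \<in> A})"
    using sum_multicount_gen[of ?T X "\<lambda>t x. Y x + t \<in> A" "\<lambda>x. card {t \<in> ?T. Y x + t \<in> A}"] assms(1)
    by simp
  also have "\<dots> = card X * card A" using c by simp
  finally have *: "(\<Sum>t\<in>?T. card {x \<in> X. Y x + t \<in> A}) = card X * card A" .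
  have "(\<Sum>t\<in>?T. card {x \<in> X. Y x + t \<in> A} * (2 * N)) < (\<Sum>t\<in>?T. card X * card A)"
    using lt N by (intro sum_strict_mono) auto
  then have "card X * card A * (2 * N) < card ?T * (card X * card A)"
    by (simp only: sum_distrib_right[symmetric] * sum_constant of_nat_id)
  then show False unfolding cT by (simp add: mult.commute)
qed

text \<open>Squaring the digits doubles the degree of a progression; since the digits stay below
  \<open>B / 2 ^ Suc D\<close>, no carries occur in differences of order \<open>Suc D\<close>, so the digits of a
  polynomial progression are again polynomial.\<close>

lemma prog_free_digit_squares:
  fixes B M t :: int
  assumes pf: "prog_free k (2 * D) A'" and k: "2 * D < k" and B: "2 ^ Suc D * (M - 1) < B"
    and X: "\<And>x j. x \<in> X \<Longrightarrow> j < m \<Longrightarrow> 0 \<le> x j \<and> x j < M"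
  shows "prog_free k D ((\<lambda>x. \<Sum>j<m. x j * B ^ j) ` {x \<in> X. (\<Sum>j<m. x j * x j) + t \<in> A'})"
  unfolding prog_free_def
proof (intro allI impI)
  fix p :: "real poly"
  assume dp: "degree p \<le> D"
    and ex: "\<forall>i<k. \<exists>a\<in>(\<lambda>x. \<Sum>j<m. x j * B ^ j) ` {x \<in> X. (\<Sum>j<m. x j * x j) + t \<in> A'}.
               poly p (of_nat i) = of_int a"
  have "\<exists>x. x \<in> X \<and> (\<Sum>j<m. x j * x j) + t \<in> A' \<and>
          poly p (of_nat i) = of_int (\<Sum>j<m. x j * B ^ j)" if "i < k" for i
    using ex that by blast
  then obtain x where x: "\<And>i. i < k \<Longrightarrow> x i \<in> X"
    "\<And>i. i < k \<Longrightarrow> (\<Sum>j<m. x i j * x i j) + t \<in> A'"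
    "\<And>i. i < k \<Longrightarrow> poly p (of_nat i) = of_int (\<Sum>j<m. x i j * B ^ j)"
    by metis
  have "\<exists>q. degree q \<le> D \<and> (\<forall>i<k. poly q (of_nat i) = real_of_int (x i j))" if j: "j < m" for j
  proof (rule poly_of_fdiff_eq_0)
    fix i
    assume i: "i + Suc D < k"
    have "real_of_int (fdiff (Suc D) (\<lambda>s. \<Sum>j<m. x s j * B ^ j) i) =
            fdiff (Suc D) (\<lambda>s. poly p (of_nat s)) i"
      unfolding of_int_fdiff using i x(3) by (intro fdiff_cong) auto
    also have "\<dots> = 0" using dp by (intro fdiff_poly_eq_0) auto
    \<comment> \<open>By linearity the vanishing difference of the values of \<open>p\<close>
      becomes a base \<open>B\<close> expansion of 0, with differences of digit sequences as its
      digits.\<close>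
    finally have "(\<Sum>j<m. fdiff (Suc D) (\<lambda>s. x s j) i * B ^ j) = 0"
      unfolding fdiff_sum_scaled of_int_eq_0_iff .
    moreover have "\<bar>fdiff (Suc D) (\<lambda>s. x s j) i\<bar> < B" if "j < m" for j
    proof -
      have "\<bar>fdiff (Suc D) (\<lambda>s. x s j) i\<bar> \<le> 2 ^ Suc D * (M - 1)"
      proof (rule abs_fdiff_le)
        fix s
        assume "s \<le> i + Suc D"
        then show "\<bar>x s j\<bar> \<le> M - 1" using X[OF x(1)[of s] \<open>j < m\<close>] i by simp
      qed
      then show ?thesis using B by linarith
    qed
    ultimately have "fdiff (Suc D) (\<lambda>s. x s j) i = 0" using j by (rule digits_eq_0)
    then show "fdiff (Suc D) (\<lambda>s. real_of_int (x s j)) i = 0"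
      using of_int_fdiff[of "Suc D" "\<lambda>s. x s j" i, where 'a = real] by (simp del: fdiff.simps)
  qed
  then obtain q where q: "\<And>j. j < m \<Longrightarrow> degree (q j) \<le> D"
    "\<And>j i. j < m \<Longrightarrow> i < k \<Longrightarrow> poly (q j) (of_nat i) = real_of_int (x i j)"
    by metis
  \<comment> \<open>The sum of squared digits is a progression of degree at most
    \<open>2 * D\<close> in the translate of \<open>A'\<close>, hence constant.\<close>
  have "degree (\<Sum>j<m. q j * q j) = 0"
  proof (rule prog_freeD[OF prog_free_translate[OF pf]])
    show "degree (\<Sum>j<m. q j * q j) \<le> 2 * D"
    proof (intro degree_sum_le)
      fix j assume "j \<in> {..<m}"
      then show "degree (q j * q j) \<le> 2 * D"
        using degree_mult_le[of "q j" "q j"] q(1)[of j] by simp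
    qed simp
    show "\<exists>a\<in>{a. a + t \<in> A'}. poly (\<Sum>j<m. q j * q j) (of_nat i) = of_int a" if "i < k" for i
      using x(2)[OF that] q(2) that by (intro bexI[of _ "\<Sum>j<m. x i j * x i j"]) (simp_all add: poly_sum)
  qed
  then have d: "degree (q j) = 0" if "j < m" for j
    using degree_eq_0_if_sum_squares[of "{..<m}" q j] that by simp
  have c: "x i j = x 0 j" if "i < k" "j < m" for i j
  proof -
    have "degree (q j) = 0" using d that(2) .
    then obtain c where "q j = [:c:]" by (metis degree_eq_zeroE)
    then show ?thesis using q(2)[OF that(2), of i] q(2)[OF that(2), of 0] that k by simp
  qed
  show "degree p = 0"
  proof (rule degree_eq_0_if_constant_on)
    show "degree p < k" using dp k by linarith
    fix i
    assume i: "i < k"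
    have "(\<Sum>j<m. x i j * B ^ j) = (\<Sum>j<m. x 0 j * B ^ j)"
      using c[OF i] by (intro sum.cong) auto
    then show "poly p (of_nat i) = of_int (\<Sum>j<m. x 0 j * B ^ j)"
      using x(3)[OF i] by metis
  qed
qed

text \<open>Two digits differ by less than \<open>B\<close> in absolute value, so
  \<open>digits_eq_0\<close> applies to the difference of the expansions; extensionality settles the
  indices from \<open>m\<close> on.\<close>

lemma inj_on_digits:
  fixes B :: int
  assumes X: "\<And>x j. x \<in> X \<Longrightarrow> j < m \<Longrightarrow> 0 \<le> x j \<and> x j < B" and "X \<subseteq> extensional {..<m}"
  shows "inj_on (\<lambda>x. \<Sum>j<m. x j * B ^ j) X"
proof (rule inj_onI)
  fix x y
  assume xy: "x \<in> X" "y \<in> X" and eq: "(\<Sum>j<m. x j * B ^ j) = (\<Sum>j<m. y j * B ^ j)"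
  have s: "(\<Sum>j<m. (x j - y j) * B ^ j) = 0" using eq by (simp add: left_diff_distrib sum_subtractf)
  have "x j - y j = 0" if "j < m" for j
  proof (rule digits_eq_0[OF s _ that])
    show "\<bar>x j - y j\<bar> < B" if "j < m" for j
      using X[OF xy(1) that] X[OF xy(2) that] by linarith
  qed
  then show "x = y" using xy assms(2) by (intro extensionalityI[of x "{..<m}"]) auto
qed

text \<open>The parameter \<open>m\<close> stands for \<open>(log 2 N) powr (1 / Suc h)\<close>, where \<open>N\<close> is the length of the
  interval.\<close>

lemma rankin_prog_free:
  assumes "D * 2 ^ h < k"
  shows "\<exists>c. \<forall>m\<ge>1. \<exists>A. A \<subseteq> {0..<2 ^ (m ^ Suc h)} \<and> prog_free k D A \<and>
           2 ^ (m ^ Suc h) \<le> card A * 2 ^ (c * m)"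
  using assms
proof (induction h arbitrary: D)
  case 0
  then have "prog_free k D {0}" by (intro prog_free_singleton) simp
  then show ?case by (intro exI[of _ 1] allI impI exI[of _ "{0}"]) auto
next
  case (Suc h)
  have "2 * D * 2 ^ h < k" using Suc.prems by (simp add: mult_ac)
  from Suc.IH[OF this] obtain c where c: "\<And>m. m \<ge> 1 \<Longrightarrow> \<exists>A. A \<subseteq> {0..<2 ^ (m ^ Suc h)} \<and>
      prog_free k (2 * D) A \<and> 2 ^ (m ^ Suc h) \<le> card A * 2 ^ (c * m)"
    by blast
  have k: "2 * D < k"
  proof -
    have "2 * D * 1 \<le> 2 * D * 2 ^ h" by (intro mult_le_mono) auto
    then show ?thesis using \<open>2 * D * 2 ^ h < k\<close> by linarith
  qed
  show ?case
  \<comment> \<open>Losses in bits per digit: \<open>Suc D\<close> for the room against carries,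
    \<open>3 * c\<close> for the density of \<open>A'\<close> at parameter \<open>3 * m\<close>, and
    at most 1 for the factor 2 of the averaging.\<close>
  proof (intro exI[of _ "Suc D + 3 * c + 1"] allI impI)
    fix m :: nat
    assume m: "1 \<le> m"
    define E where "E = m ^ Suc h"
    have mE: "m ^ Suc (Suc h) = E * m" by (simp add: E_def)
    show "\<exists>A. A \<subseteq> {0..<2 ^ (m ^ Suc (Suc h))} \<and> prog_free k D A \<and>
            2 ^ (m ^ Suc (Suc h)) \<le> card A * 2 ^ ((Suc D + 3 * c + 1) * m)"
    proof (cases "E < Suc D")
      \<comment> \<open>A digit has no room for the guard bits, but the interval is so short that a
        singleton is dense enough.\<close>
      case True
      then have "E * m \<le> (Suc D + 3 * c + 1) * m" by (intro mult_le_mono) auto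
      then show ?thesis unfolding mE using k
        by (intro exI[of _ "{0}"] conjI prog_free_singleton) (auto intro!: power_increasing)
    next
      case False
      \<comment> \<open>Numbers are read as \<open>m\<close> digits of \<open>E\<close> bits each;
        keeping the top \<open>Suc D\<close> bits of every digit zero prevents carries.\<close>
      define M :: nat where "M = 2 ^ (E - Suc D)"
      define B :: nat where "B = 2 ^ E"
      have BM: "B = 2 ^ Suc D * M"
        unfolding B_def M_def power_add[symmetric] using False by simp
      have M: "M \<ge> 1" by (simp add: M_def)
      have MB: "M \<le> B" using M by (simp add: BM)
      \<comment> \<open>The sums of squares stay below \<open>2 ^ (3 * E)\<close>, and
        \<open>3 * E\<close> is at most \<open>(3 * m) ^ Suc h\<close>; this is why the induction
        hypothesis is used at \<open>3 * m\<close>.\<close>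
      define N :: nat where "N = 2 ^ ((3 * m) ^ Suc h)"
      obtain A' where A': "A' \<subseteq> {0..<int N}" "prog_free k (2 * D) A'"
        "N \<le> card A' * 2 ^ (c * (3 * m))"
        using c[of "3 * m"] m unfolding N_def by auto
      define X where "X = {..<m} \<rightarrow>\<^sub>E {0..<int M}"
      have fX: "finite X" by (simp add: X_def finite_PiE)
      have cX: "card X = M ^ m" by (simp add: X_def card_PiE)
      have X: "0 \<le> x j \<and> x j < int M" if "x \<in> X" "j < m" for x j
        using that by (auto simp: X_def PiE_def Pi_def)
      have mMN: "m * (M * M) < N"
      proof -
        have "E \<ge> m" unfolding E_def using m by (intro self_le_power) auto
        then have "m < 2 ^ E" by (meson less_exp le_less_trans order.strict_trans1)
        then have "m * (M * M) < 2 ^ E * (M * M)" using M by simp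
        also have "\<dots> \<le> 2 ^ E * (B * B)" using MB by (intro mult_le_mono) auto
        also have "\<dots> = 2 ^ (3 * E)" by (simp add: B_def power_add[symmetric])
        also have "\<dots> \<le> N"
        proof -
          have "(3::nat) \<le> 3 ^ Suc h" by simp
          then have "3 * E \<le> (3 * m) ^ Suc h"
            unfolding power_mult_distrib E_def by (intro mult_le_mono) auto
          then show ?thesis unfolding N_def by (intro power_increasing) auto
        qed
        finally show ?thesis .
      qed
      have Y: "0 \<le> (\<Sum>j<m. x j * x j) \<and> (\<Sum>j<m. x j * x j) < int N" if "x \<in> X" for x
      proof -
        have "(\<Sum>j<m. x j * x j) \<le> (\<Sum>j<m. int M * int M)"
          using X[OF that] by (intro sum_mono mult_mono) (auto intro: less_imp_le)
        also have "\<dots> < int N" using mMN by (simp flip: of_nat_mult)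
        finally show ?thesis by (auto intro: sum_nonneg)
      qed
      obtain t where t: "card X * card A' \<le>
          card {x \<in> X. (\<Sum>j<m. x j * x j) + t \<in> A'} * (2 * N)"
        using exists_translate_many[of X "\<lambda>x. \<Sum>j<m. x j * x j", OF fX Y A'(1)] ..
      define X' where "X' = {x \<in> X. (\<Sum>j<m. x j * x j) + t \<in> A'}"
      define A where "A = (\<lambda>x. \<Sum>j<m. x j * int B ^ j) ` X'"
      have XB: "0 \<le> x j \<and> x j < int B" if "x \<in> X" "j < m" for x j
        using X[OF that] MB by auto
      have "X' \<subseteq> extensional {..<m}" unfolding X'_def X_def PiE_def by blast
      moreover have "0 \<le> x j \<and> x j < int B" if "x \<in> X'" "j < m" for x j
      proof (rule XB)
        show "x \<in> X" using that(1) by (simp only: X'_def mem_Collect_eq)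
      qed (rule that(2))
      ultimately have "inj_on (\<lambda>x. \<Sum>j<m. x j * int B ^ j) X'" by (intro inj_on_digits)
      then have "card A = card X'" unfolding A_def by (rule card_image)
      then have "M ^ m * card A' \<le> card A * (2 * N)" using t by (simp add: X'_def cX)
      \<comment> \<open>Bounding \<open>N\<close> through the density of \<open>A'\<close> makes
        \<open>card A'\<close> cancel.\<close>
      also have "\<dots> \<le> card A * (2 * (card A' * 2 ^ (c * (3 * m))))"
        using A'(3) by (intro mult_le_mono) auto
      finally have "card A' * M ^ m \<le> card A' * (card A * (2 * 2 ^ (c * (3 * m))))"
        by (simp add: mult_ac)
      moreover have "card A' > 0" using A'(3) by (cases "card A' = 0") (auto simp: N_def)
      ultimately have cA: "M ^ m \<le> card A * (2 * 2 ^ (c * (3 * m)))" by simp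
      have "2 ^ (E * m) = B ^ m" by (simp add: B_def power_mult)
      also have "\<dots> = 2 ^ (Suc D * m) * M ^ m" by (simp only: BM power_mult_distrib power_mult)
      also have "\<dots> \<le> 2 ^ (Suc D * m) * (card A * (2 * 2 ^ (c * (3 * m))))"
        using cA by (intro mult_le_mono) auto
      also have "\<dots> = card A * 2 ^ (Suc D * m + c * (3 * m) + 1)"
        by (simp add: power_add)
      also have "\<dots> \<le> card A * 2 ^ ((Suc D + 3 * c + 1) * m)"
        using m by (intro mult_le_mono power_increasing) (auto simp: algebra_simps)
      finally have card: "2 ^ (E * m) \<le> card A * 2 ^ ((Suc D + 3 * c + 1) * m)" .
      have "prog_free k D A"
        unfolding A_def X'_def
      proof (rule prog_free_digit_squares[where M = "int M", OF A'(2) k])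
        show "2 ^ Suc D * (int M - 1) < int B" by (simp add: BM right_diff_distrib)
        show "0 \<le> x j \<and> x j < int M" if "x \<in> X" "j < m" for x j using X that .
      qed
      moreover have "A \<subseteq> {0..<2 ^ (E * m)}"
      proof
        fix a
        assume "a \<in> A"
        then obtain x where x: "x \<in> X" "a = (\<Sum>j<m. x j * int B ^ j)" by (auto simp: A_def X'_def)
        have "a < int B ^ m" unfolding x(2) using XB[OF x(1)] by (intro digits_less) auto
        moreover have "a \<ge> 0" unfolding x(2) using XB[OF x(1)] by (intro sum_nonneg) auto
        ultimately show "a \<in> {0..<2 ^ (E * m)}" by (simp add: B_def power_mult)
      qed
      ultimately show ?thesis unfolding mE using card by blast
    qed
  qed
qed

section \<open>The game of a progression-free set\<close>

lemma finite_strategies: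
  assumes "\<And>j. j < provers G \<Longrightarrow> finite (question_alphabet G j) \<and> finite (answer_alphabet G j)"
  shows "finite (strategies G)"
  unfolding strategies_def using assms by (intro finite_PiE) auto

lemma success_prob_le_game_value:
  assumes "finite (strategies G)" and "S \<in> strategies G"
  shows "success_prob G S \<le> game_value G"
  unfolding game_value_def using assms by (intro Max_ge) auto

lemma game_value_leI:
  assumes "finite (strategies G)" and "strategies G \<noteq> {}"
    and "\<And>S. S \<in> strategies G \<Longrightarrow> success_prob G S \<le> v"
  shows "game_value G \<le> v"
  unfolding game_value_def using assms by (subst Max_le_iff) auto

section \<open>One-hot questions\<close>

lemma one_hot_questions_eq:
  "one_hot_questions r = (\<lambda>s. \<lambda>j\<in>{..<r}. if j = s then 1 else 0) ` {..<r}"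
proof (intro equalityI subsetI)
  fix q
  assume "q \<in> one_hot_questions r"
  then have q: "q \<in> {..<r} \<rightarrow>\<^sub>E {0, 1}" and "\<exists>!j. j < r \<and> q j = 1"
    by (auto simp: one_hot_questions_def)
  then obtain s where s: "s < r" "q s = 1" "\<And>j. j < r \<Longrightarrow> q j = 1 \<Longrightarrow> j = s" by blast
  have "q = (\<lambda>j\<in>{..<r}. if j = s then 1 else 0)"
  proof (rule extensionalityI[of _ "{..<r}"])
    show "q \<in> extensional {..<r}" using q by (auto simp: PiE_def)
    fix j
    assume j: "j \<in> {..<r}"
    have "q j \<in> {0, 1}" using q j by (rule PiE_mem)
    moreover have "q j = 1 \<longleftrightarrow> j = s" using s(2) s(3)[of j] j by blast
    ultimately show "q j = (\<lambda>j\<in>{..<r}. if j = s then 1 else 0) j" using j by auto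
  qed simp
  then show "q \<in> (\<lambda>s. \<lambda>j\<in>{..<r}. if j = s then 1 else 0) ` {..<r}" using s(1) by blast
next
  fix q :: "nat \<Rightarrow> nat"
  assume "q \<in> (\<lambda>s. \<lambda>j\<in>{..<r}. if j = s then 1 else 0) ` {..<r}"
  then obtain s where "s < r" "q = (\<lambda>j\<in>{..<r}. if j = s then 1 else 0)" by auto
  then show "q \<in> one_hot_questions r"
    unfolding one_hot_questions_def by (auto split: if_splits intro!: ex1I[of _ s])
qed

lemma card_one_hot_questions: "card (one_hot_questions r) = r"
proof -
  have "inj_on (\<lambda>s. \<lambda>j\<in>{..<r}. if j = s then 1 else (0::nat)) {..<r}"
  proof (rule inj_onI)
    fix s t
    assume st: "s \<in> {..<r}" "t \<in> {..<r}"
      and "(\<lambda>j\<in>{..<r}. if j = s then 1 else (0::nat)) = (\<lambda>j\<in>{..<r}. if j = t then 1 else 0)"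
    then have "(\<lambda>j\<in>{..<r}. if j = s then 1 else (0::nat)) s = (\<lambda>j\<in>{..<r}. if j = t then 1 else 0) s"
      by simp
    then show "s = t" using st by (simp split: if_splits)
  qed
  then show ?thesis unfolding one_hot_questions_eq by (simp add: card_image)
qed

lemma is_question_set_one_hot:
  assumes "r \<ge> 2"
  shows "is_question_set r (\<lambda>j. {0, 1}) (one_hot_questions r)"
  unfolding is_question_set_def
proof (intro conjI allI impI ballI)
  show "one_hot_questions r \<noteq> {}" using assms by (auto simp: one_hot_questions_eq lessThan_empty_iff)
  show "one_hot_questions r \<subseteq> {..<r} \<rightarrow>\<^sub>E {0, 1}" by (auto simp: one_hot_questions_def)
  fix j and x :: nat
  assume j: "j < r" and x: "x \<in> {0, 1}"
  \<comment> \<open>Some prover other than \<open>j\<close>, to carry the 1 when prover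
    \<open>j\<close> is to receive 0.\<close>
  define s :: nat where "s = (if j = 0 then 1 else 0)"
  have s: "s < r" "s \<noteq> j" using assms by (auto simp: s_def)
  have "(\<lambda>i\<in>{..<r}. if i = (if x = 1 then j else s) then 1 else 0) \<in> one_hot_questions r"
    unfolding one_hot_questions_eq using j s by (intro imageI) auto
  moreover have "(\<lambda>i\<in>{..<r}. if i = (if x = 1 then j else s) then 1 else 0) j = x"
    using j s x by auto
  ultimately show "\<exists>q\<in>one_hot_questions r. q j = x" by blast
qed simp

section \<open>The verifier and its combinatorial lines\<close>

text \<open>On one-hot inputs, read as points of \<open>{..<r} ^ n\<close> by recording which prover
  holds the 1 in each coordinate, this is the coordinate sum.\<close>

definition weighted_count :: "nat \<Rightarrow> nat \<Rightarrow> (nat \<Rightarrow> nat \<Rightarrow> nat) \<Rightarrow> int" where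
  "weighted_count r n y = (\<Sum>j<r. int j * (\<Sum>i<n. int (y j i)))"

text \<open>An answer of prover \<open>j\<close> encodes a claimed input \<open>y j\<close> in \<open>n\<close> coordinates together with the
  coordinate \<open>i\<close> in which the single question is claimed to sit.\<close>

definition accepts ::
    "nat \<Rightarrow> nat \<Rightarrow> int set \<Rightarrow> (nat \<Rightarrow> nat) \<Rightarrow> (nat \<Rightarrow> nat \<Rightarrow> nat) \<Rightarrow> (nat \<Rightarrow> nat) \<Rightarrow> bool" where
  "accepts r n A q y h \<longleftrightarrow>
     (\<exists>i<n. \<forall>j<r. h j = i \<and> y j i = q j) \<and> (\<forall>i<n. (\<Sum>j<r. y j i) = 1) \<and> weighted_count r n y \<in> A"

lemma accepts_cong:
  assumes "\<And>j. j < r \<Longrightarrow> y j = y' j" and "\<And>j. j < r \<Longrightarrow> h j = h' j"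
    and "\<And>j. j < r \<Longrightarrow> q j = q' j"
  shows "accepts r n A q y h \<longleftrightarrow> accepts r n A q' y' h'"
proof -
  have "(\<Sum>j<r. y j i) = (\<Sum>j<r. y' j i)" for i using assms(1) by (intro sum.cong) auto
  moreover have "weighted_count r n y = weighted_count r n y'"
    unfolding weighted_count_def using assms(1) by (intro sum.cong) auto
  ultimately show ?thesis using assms unfolding accepts_def by (metis (no_types, lifting))
qed

text \<open>Answers are coded as numbers: \<open>n * 2 ^ n\<close> is the number of pairs of a bit
  vector of length \<open>n\<close> and a coordinate, and \<open>dec\<close> recovers the
  pair.\<close>

definition coordinate_game ::
    "nat \<Rightarrow> nat \<Rightarrow> int set \<Rightarrow> (nat \<Rightarrow> (nat \<Rightarrow> nat) \<times> nat) \<Rightarrow> (nat, nat) game" where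
  "coordinate_game r n A dec =
     \<lparr> provers = r,
       question_alphabet = (\<lambda>j. {0, 1}),
       question_set = one_hot_questions r,
       answer_alphabet = (\<lambda>j. {..<n * 2 ^ n}),
       verifier = (\<lambda>q a. accepts r n A q (\<lambda>j. fst (dec (a j))) (\<lambda>j. snd (dec (a j)))) \<rparr>"

text \<open>Isolates the effect of handing question 1 to prover \<open>s\<close>; it is applied to
  the bit sum in one coordinate and to the weighted count.\<close>

lemma sum_one_hot:
  fixes f :: "nat \<Rightarrow> nat \<Rightarrow> int"
  assumes "s < r"
  shows "(\<Sum>j<r. f j (if j = s then 1 else 0)) = (\<Sum>j<r. f j 0) + (f s 1 - f s 0)"
proof -
  have "(\<Sum>j<r. f j (if j = s then 1 else 0)) = (\<Sum>j<r. f j 0 + (if j = s then f s 1 - f s 0 else 0))"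
    by (intro sum.cong) auto
  then show ?thesis using assms by (simp add: sum.distrib)
qed

text \<open>A strategy winning on all \<open>r\<close> questions yields a combinatorial line in \<open>{..<r} ^ n\<close>, along
  which the weighted count runs through an \<open>r\<close>-term arithmetic progression; its difference
  \<open>\<Sum>i<n. d i\<close> is the number of active coordinates.\<close>

lemma not_all_accepted:
  fixes y :: "nat \<Rightarrow> nat \<Rightarrow> nat \<Rightarrow> nat" and h :: "nat \<Rightarrow> nat \<Rightarrow> nat"
  assumes r: "r \<ge> 3" and A: "prog_free r 1 A"
    and y: "\<And>j b i. j < r \<Longrightarrow> b \<in> {0, 1} \<Longrightarrow> i < n \<Longrightarrow> y j b i \<le> 1"
    and acc: "\<And>s. s < r \<Longrightarrow> accepts r n A (\<lambda>j\<in>{..<r}. if j = s then 1 else 0)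
        (\<lambda>j. y j (if j = s then 1 else 0)) (\<lambda>j. h j (if j = s then 1 else 0))"
  shows False
proof -
  \<comment> \<open>The bit sum must be 1 whichever prover \<open>s\<close> gets question 1, so all
    provers change their bit in coordinate \<open>i\<close> by the same amount
    \<open>d i\<close>.\<close>
  define d where "d i = 1 - (\<Sum>j<r. int (y j 0 i))" for i
  have d: "int (y s 1 i) - int (y s 0 i) = d i" if "s < r" "i < n" for s i
  proof -
    have "(\<Sum>j<r. y j (if j = s then 1 else 0) i) = 1"
      using acc[OF that(1)] that(2) by (simp add: accepts_def)
    then have "(\<Sum>j<r. int (y j (if j = s then 1 else 0) i)) = 1"
      by (simp flip: of_nat_sum)
    then show ?thesis
      using sum_one_hot[OF that(1), of "\<lambda>j b. int (y j b i)"] by (simp add: d_def)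
  qed
  \<comment> \<open>A negative \<open>d i\<close> would force all bits on question 0 to be 1, so
    \<open>d i = 1 - int r\<close>, at most -2 as \<open>r\<close> is at least 3; but a bit changes
    by at least -1.\<close>
  have d_nonneg: "d i \<ge> 0" if i: "i < n" for i
  proof (rule ccontr)
    assume neg: "\<not> d i \<ge> 0"
    have "y s 0 i = 1" if "s < r" for s
      using d[OF that i] neg y[OF that _ i, of 0] by simp
    then have "d i = 1 - int r" by (simp add: d_def)
    moreover have "y 0 1 i \<ge> 0" "y 0 0 i \<le> 1" using y[of 0 0 i] r i by auto
    ultimately show False using d[of 0 i] r i by simp
  qed
  obtain i0 where i0: "i0 < n" "\<And>j. j < r \<Longrightarrow> h j (if j = 0 then 1 else 0) = i0 \<and>
      y j (if j = 0 then 1 else 0) i0 = (if j = 0 then 1 else 0)"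
    using acc[of 0] r by (auto simp: accepts_def)
  obtain i1 where i1: "i1 < n" "\<And>j. j < r \<Longrightarrow> h j (if j = 1 then 1 else 0) = i1 \<and>
      y j (if j = 1 then 1 else 0) i1 = (if j = 1 then 1 else 0)"
    using acc[of 1] r by (auto simp: accepts_def)
  \<comment> \<open>Prover 2 receives 0 whether prover 0 or prover 1 gets the 1, so it names the
    same coordinate both times. There prover 0 claims exactly its own question, which makes the
    coordinate active.\<close>
  have "i1 = i0" using i0(2)[of 2] i1(2)[of 2] r by simp
  then have "d i0 = 1" using i0(2)[of 0] i1(2)[of 0] d[of 0 i0] i0(1) r by simp
  then have pos: "(\<Sum>i<n. d i) > 0"
    using d_nonneg i0(1) by (intro sum_pos2[of _ i0]) auto
  define K where "K = (\<Sum>j<r. int j * (\<Sum>i<n. int (y j 0 i)))"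
  have count: "weighted_count r n (\<lambda>j. y j (if j = s then 1 else 0)) = K + int s * (\<Sum>i<n. d i)"
    if s: "s < r" for s
  proof -
    have "(\<Sum>i<n. int (y s 1 i)) - (\<Sum>i<n. int (y s 0 i)) = (\<Sum>i<n. d i)"
      unfolding sum_subtractf[symmetric] using d[OF s] by (intro sum.cong) auto
    then show ?thesis
      using sum_one_hot[OF s, of "\<lambda>j b. int j * (\<Sum>i<n. int (y j b i))"]
      by (simp add: weighted_count_def K_def right_diff_distrib flip: right_diff_distrib)
  qed
  have "degree [:real_of_int K, real_of_int (\<Sum>i<n. d i):] = 0"
  proof (rule prog_freeD[OF A])
    show "\<exists>a\<in>A. poly [:real_of_int K, real_of_int (\<Sum>i<n. d i):] (of_nat s) = of_int a"
      if "s < r" for s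
      using acc[OF that] count[OF that]
      by (intro bexI[of _ "K + int s * (\<Sum>i<n. d i)"]) (simp_all add: accepts_def del: of_int_sum)
  qed simp
  then show False using pos by (simp del: of_int_sum split: if_splits)
qed

section \<open>Values of the game and of its repetition\<close>

text \<open>By \<open>not_all_accepted\<close> every strategy loses at least one of the
  \<open>r\<close> equally likely questions.\<close>

lemma coordinate_game_value_le:
  assumes r: "r \<ge> 3" and n: "n \<ge> 1" and A: "prog_free r 1 A"
    and dec: "dec \<in> {..<n * 2 ^ n} \<rightarrow> ({..<n} \<rightarrow>\<^sub>E {0, 1}) \<times> {..<n}"
  shows "game_value (coordinate_game r n A dec) \<le> 1 - 1 / real r"
proof (rule game_value_leI)
  let ?G = "coordinate_game r n A dec"
  show "finite (strategies ?G)" by (rule finite_strategies) (simp add: coordinate_game_def)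
  show "strategies ?G \<noteq> {}" using n
    by (auto simp: strategies_def coordinate_game_def PiE_eq_empty_iff lessThan_empty_iff)
  fix S
  assume S: "S \<in> strategies ?G"
  let ?W = "{q \<in> one_hot_questions r. verifier ?G q (\<lambda>j\<in>{..<r}. S j (q j))}"
  let ?u = "\<lambda>s. \<lambda>j\<in>{..<r}. if j = s then 1 else (0::nat)"
  define y where "y j b = fst (dec (S j b))" for j b
  define h where "h j b = snd (dec (S j b))" for j b
  have G: "provers ?G = r" "question_set ?G = one_hot_questions r"
    by (simp_all add: coordinate_game_def)
  have fin: "finite (one_hot_questions r)" by (simp add: one_hot_questions_eq)
  have "?W \<noteq> one_hot_questions r"
  proof
    assume W: "?W = one_hot_questions r"
    show False
    proof (rule not_all_accepted[OF r A])
      fix j b i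
      assume jb: "j < r" "b \<in> {0, 1::nat}" and i: "i < n"
      then have "S j b \<in> {..<n * 2 ^ n}"
        using S by (auto simp: strategies_def coordinate_game_def PiE_def Pi_def)
      then have "y j b \<in> {..<n} \<rightarrow>\<^sub>E {0, 1}" using dec unfolding y_def by (metis funcset_mem mem_Times_iff)
      then have "y j b i \<in> {0, 1}" using i by (auto simp: PiE_def Pi_def)
      then show "y j b i \<le> 1" by auto
    next
      fix s
      assume "s < r"
      then have "?u s \<in> one_hot_questions r" unfolding one_hot_questions_eq by blast
      then have "verifier ?G (?u s) (\<lambda>j\<in>{..<r}. S j (?u s j))" using W by blast
      then have "accepts r n A (?u s) (\<lambda>j. fst (dec ((\<lambda>j\<in>{..<r}. S j (?u s j)) j)))
          (\<lambda>j. snd (dec ((\<lambda>j\<in>{..<r}. S j (?u s j)) j)))"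
        unfolding coordinate_game_def game.simps .
      also have "?this \<longleftrightarrow> accepts r n A (?u s) (\<lambda>j. y j (if j = s then 1 else 0))
          (\<lambda>j. h j (if j = s then 1 else 0))"
        by (rule accepts_cong) (simp_all only: y_def h_def restrict_apply' lessThan_iff)
      finally show "accepts r n A (?u s) (\<lambda>j. y j (if j = s then 1 else 0))
          (\<lambda>j. h j (if j = s then 1 else 0))" .
    qed
  qed
  then have "?W \<subset> one_hot_questions r" by blast
  then have "card ?W < r" by (rule psubset_card_mono[OF fin, unfolded card_one_hot_questions])
  then have "real (card ?W) \<le> real r - 1" by linarith
  then have "real (card ?W) / real r \<le> (real r - 1) / real r" by (rule divide_right_mono) simp
  also have "\<dots> = 1 - 1 / real r" using r by (simp add: diff_divide_distrib)
  finally show "success_prob ?G S \<le> 1 - 1 / real r"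
    unfolding success_prob_def G card_one_hot_questions .
qed

lemma coordinate_game_repetition_value_ge:
  fixes r n :: nat and A :: "int set" and enc :: "(nat \<Rightarrow> nat) \<times> nat \<Rightarrow> nat"
  defines "X \<equiv> ({..<n} \<rightarrow>\<^sub>E {0, 1::nat}) \<times> {..<n}"
  assumes enc: "enc \<in> X \<rightarrow> {..<n * 2 ^ n}" and dec: "\<And>x. x \<in> X \<Longrightarrow> dec (enc x) = x"
  defines "P \<equiv> parallel_repetition n (coordinate_game r n A dec)"
  shows "real (card {q \<in> question_set P. weighted_count r n q \<in> A}) / real (card (question_set P))
           \<le> game_value P"
proof -
  let ?I = "{..<n} \<rightarrow>\<^sub>E {0, 1::nat}"
  have prv: "provers P = r" by (simp add: P_def parallel_repetition_def coordinate_game_def)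
  have fin: "finite (strategies P)"
    by (rule finite_strategies)
      (auto simp: P_def parallel_repetition_def coordinate_game_def intro!: finite_PiE)
  \<comment> \<open>The honest strategy: in coordinate \<open>i\<close> a prover reports its whole
    input together with \<open>i\<close>. It wins all coordinates at once or none.\<close>
  define S where "S = (\<lambda>j\<in>{..<r}. \<lambda>x\<in>?I. \<lambda>i\<in>{..<n}. enc (x, i))"
  have S: "S \<in> strategies P"
  proof -
    have "enc (x, i) \<in> {..<n * 2 ^ n}" if "x \<in> ?I" "i < n" for x i
      using enc that by (auto simp: X_def Pi_def)
    then have "(\<lambda>x\<in>?I. \<lambda>i\<in>{..<n}. enc (x, i)) \<in> ?I \<rightarrow>\<^sub>E ({..<n} \<rightarrow>\<^sub>E {..<n * 2 ^ n})"
      by (intro restrict_PiE_iff[THEN iffD2] ballI) simp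
    then show ?thesis
      unfolding S_def by (simp add: strategies_def P_def parallel_repetition_def coordinate_game_def
          restrict_PiE_iff)
  qed
  have finq: "finite (question_set P)"
  proof (rule finite_subset)
    show "question_set P \<subseteq> ({..<r} \<rightarrow>\<^sub>E ?I)"
      by (auto simp: P_def parallel_repetition_def coordinate_game_def)
  qed (intro finite_PiE, auto intro!: finite_PiE)
  have win: "verifier P q (\<lambda>j\<in>{..<r}. S j (q j))"
    if q: "q \<in> question_set P" and A: "weighted_count r n q \<in> A" for q
  proof -
    have qI: "q j \<in> ?I" if "j < r" for j
      using q that by (auto simp: P_def parallel_repetition_def coordinate_game_def PiE_def Pi_def)
    have one: "coord r q i \<in> one_hot_questions r" if "i < n" for i
      using q that by (auto simp: P_def parallel_repetition_def coordinate_game_def)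
    have sum1: "(\<Sum>j<r. q j i) = 1" if i: "i < n" for i
    proof -
      obtain s where s: "s < r" "coord r q i = (\<lambda>j\<in>{..<r}. if j = s then 1 else 0)"
        using one[OF i] by (auto simp: one_hot_questions_eq)
      have "(\<Sum>j<r. q j i) = (\<Sum>j<r. coord r q i j)" by (simp add: coord_def)
      also have "\<dots> = 1" using s by simp
      finally show ?thesis .
    qed
    have dec': "dec (enc (q j, i)) = (q j, i)" if "j < r" "i < n" for i j
      using qI that by (intro dec) (auto simp: X_def)
    have "accepts r n A (coord r q i)
        (\<lambda>j. fst (dec (coord r (\<lambda>j\<in>{..<r}. S j (q j)) i j)))
        (\<lambda>j. snd (dec (coord r (\<lambda>j\<in>{..<r}. S j (q j)) i j)))" if i: "i < n" for i
    proof -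
      have "coord r (\<lambda>j\<in>{..<r}. S j (q j)) i j = enc (q j, i)" if "j < r" for j
        using that i qI[OF that] by (simp add: coord_def S_def)
      then have "dec (coord r (\<lambda>j\<in>{..<r}. S j (q j)) i j) = (q j, i)" if "j < r" for j
        using dec' that i by simp
      then have "accepts r n A (coord r q i)
          (\<lambda>j. fst (dec (coord r (\<lambda>j\<in>{..<r}. S j (q j)) i j)))
          (\<lambda>j. snd (dec (coord r (\<lambda>j\<in>{..<r}. S j (q j)) i j))) \<longleftrightarrow>
          accepts r n A (\<lambda>j. q j i) q (\<lambda>j. i)"
        by (intro accepts_cong) (simp_all add: coord_def)
      then show ?thesis using A sum1 i by (auto simp: accepts_def)
    qed
    then show ?thesis by (simp add: P_def parallel_repetition_def coordinate_game_def)
  qed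
  have "card {q \<in> question_set P. weighted_count r n q \<in> A} \<le>
      card {q \<in> question_set P. verifier P q (\<lambda>j\<in>{..<r}. S j (q j))}"
    using win finq by (intro card_mono) auto
  then have "real (card {q \<in> question_set P. weighted_count r n q \<in> A}) / real (card (question_set P))
      \<le> success_prob P S"
    unfolding success_prob_def prv by (intro divide_right_mono) auto
  also have "\<dots> \<le> game_value P" using fin S by (rule success_prob_le_game_value)
  finally show ?thesis .
qed

text \<open>Each coordinate contributes the index of the prover holding the 1, which is at most
  \<open>r - 1\<close>.\<close>

lemma weighted_count_bounds:
  assumes q: "q \<in> question_set (parallel_repetition n (coordinate_game r n A dec))" and n: "n \<ge> 1" "r \<ge> 1"
  shows "0 \<le> weighted_count r n q \<and> weighted_count r n q < int (r * n)"
proof -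
  have qI: "q j i \<in> {0, 1}" if "j < r" "i < n" for j i
    using q that by (auto simp: parallel_repetition_def coordinate_game_def PiE_def Pi_def)
  have "(\<Sum>j<r. int j * int (q j i)) \<le> int r - 1" if i: "i < n" for i
  proof -
    obtain s where s: "s < r" "coord r q i = (\<lambda>j\<in>{..<r}. if j = s then 1 else 0)"
      using q i by (auto simp: parallel_repetition_def coordinate_game_def one_hot_questions_eq)
    have "q j i = (if j = s then 1 else 0)" if "j < r" for j
      using fun_cong[OF s(2), of j] that by (simp add: coord_def)
    then have "(\<Sum>j<r. int j * int (q j i)) = (\<Sum>j<r. if j = s then int s else 0)"
      by (intro sum.cong) auto
    then show ?thesis using s(1) by simp
  qed
  then have "(\<Sum>i<n. \<Sum>j<r. int j * int (q j i)) \<le> (\<Sum>i<n. int r - 1)"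
    by (intro sum_mono) auto
  also have "\<dots> < int (r * n)" using n by (simp add: algebra_simps)
  also have "(\<Sum>i<n. \<Sum>j<r. int j * int (q j i)) = weighted_count r n q"
    unfolding weighted_count_def sum_distrib_left by (rule sum.swap)
  finally show ?thesis by (auto simp: weighted_count_def intro!: sum_nonneg mult_nonneg_nonneg)
qed

section \<open>Choice of parameters\<close>

text \<open>The logarithm of \<open>K\<close> lies between \<open>r * n\<close> and
  \<open>2 * r * n\<close>. The lower bound serves the iterated logarithm, the upper one the
  denominator. In the constant, \<open>4 * r\<close> is the product of 2 from the bound on
  \<open>m\<close> and \<open>2 * r\<close> from the denominator, and \<open>c + 1\<close> absorbs
  the summand 1.\<close>

lemma exp_loglog_bound:
  fixes r n c K l m :: nat
  assumes r: "r \<ge> 1" and n: "n \<ge> 2" and m: "m \<ge> 1" "real m \<le> 2 * log 2 (real (r * n)) powr (1 / real l)"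
    and K: "2 ^ (r * n) \<le> K" "K \<le> 2 ^ (2 * r * n)"
  shows "exp (- real (4 * r * (c + 1)) * real n * (log 2 (log 2 (real K)) powr (1 / real l) / log 2 (real K)))
           \<le> 1 / 2 ^ (c * m + 1)"
proof -
  define L where "L = log 2 (real K)"
  define x where "x = log 2 (real (r * n)) powr (1 / real l)"
  have rn: "real (r * n) \<ge> 2" using mult_le_mono[OF r n] by (simp flip: of_nat_mult)
  have K0: "K > 0" using K(1) by (metis gr0I le_zero_eq power_not_zero zero_neq_numeral)
  have "real (2 ^ (r * n)) \<le> real K" "real K \<le> real (2 ^ (2 * r * n))"
    using K by (simp_all only: of_nat_le_iff)
  then have "log 2 (2 ^ (r * n)) \<le> L" "L \<le> log 2 (2 ^ (2 * r * n))"
    unfolding L_def using K0 by (auto simp del: log_pow_cancel)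
  then have L: "real (r * n) \<le> L" "L \<le> 2 * real (r * n)" by (simp_all add: log_nat_power mult_ac)
  have L0: "L > 0" using L(1) rn by linarith
  have "log 2 (real (r * n)) \<le> log 2 L" using L(1) rn L0 by simp
  moreover have "log 2 (real (r * n)) \<ge> 1" using rn by simp
  ultimately have x: "x \<le> log 2 L powr (1 / real l)" "x \<ge> 0"
    unfolding x_def by (auto intro!: powr_mono2)
  have "real (c * m + 1) * ln 2 \<le> real (c * m + 1) * 1"
    using ln_2_less_1 by (intro mult_left_mono) auto
  also have "\<dots> \<le> real ((c + 1) * m)"
    using m(1) unfolding mult_1_right of_nat_le_iff by simp
  also have "\<dots> \<le> real (c + 1) * (2 * x)" unfolding of_nat_mult x_def using m(2) by (intro mult_left_mono) auto
  also have "\<dots> = real (4 * r * (c + 1)) * real n * (x / (2 * real (r * n)))"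
    using r n by (simp add: divide_simps) (simp add: algebra_simps)
  also have "\<dots> \<le> real (4 * r * (c + 1)) * real n * (log 2 L powr (1 / real l) / L)"
    using x L L0 by (intro mult_left_mono frac_le) auto
  finally have "exp (- real (4 * r * (c + 1)) * real n * (log 2 L powr (1 / real l) / L))
      \<le> exp (- (real (c * m + 1) * ln 2))"
    unfolding exp_le_cancel_iff mult_minus_left neg_le_iff_le .
  also have "\<dots> = 1 / 2 ^ (c * m + 1)"
    by (simp only: exp_minus exp_of_nat_mult exp_ln zero_less_numeral inverse_eq_divide)
  finally show ?thesis unfolding L_def .
qed

text \<open>Rounding the root \<open>x\<close> up at most doubles it, since \<open>R\<close> being
  at least 2 gives that \<open>x\<close> is at least 1.\<close>

lemma exists_root_exponent:
  fixes R l :: nat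
  assumes R: "R \<ge> 2" and l: "l \<ge> 1"
  shows "\<exists>m\<ge>1. R \<le> 2 ^ (m ^ l) \<and> real m \<le> 2 * log 2 (real R) powr (1 / real l)"
proof -
  define x where "x = log 2 (real R) powr (1 / real l)"
  have lg: "log 2 (real R) \<ge> 1" using R by simp
  then have x1: "x \<ge> 1" unfolding x_def by (intro ge_one_powr_ge_zero) auto
  define m where "m = nat \<lceil>x\<rceil>"
  have m: "x \<le> real m" "real m \<le> x + 1" using x1 unfolding m_def by linarith+
  have "log 2 (real R) = x ^ l"
    using lg l by (simp add: x_def powr_realpow[symmetric] powr_powr)
  also have "\<dots> \<le> real m ^ l" using m x1 by (intro power_mono) auto
  finally have "log 2 (real R) \<le> real (m ^ l)" by simp
  then have "real R \<le> 2 powr real (m ^ l)" using R by (subst (asm) log_le_iff) auto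
  then have "real R \<le> real (2 ^ (m ^ l))" by (simp add: powr_realpow flip: of_nat_power)
  then have "R \<le> 2 ^ (m ^ l)" by (simp only: of_nat_le_iff)
  moreover have "m \<ge> 1" "real m \<le> 2 * x" using m x1 by linarith+
  ultimately show ?thesis unfolding x_def by blast
qed

theorem theorem4p2:
  fixes l r :: nat
  assumes "l \<ge> 2" and "r = 2 ^ (l - 1) + 1"
  shows "\<exists>C::real. C > 0 \<and>
    (\<forall>n::nat. n \<ge> 2 \<longrightarrow>
      (\<exists>G :: (nat, nat) game.
        is_game G \<and> provers G = r \<and>
        (\<forall>j<r. question_alphabet G j = {0, 1}) \<and>
        question_set G = one_hot_questions r \<and>
        game_value G \<le> 1 - 1 / real r \<and>
        2 ^ (r * n) \<le> card (answer_set G) \<and> card (answer_set G) \<le> 2 ^ (2 * r * n) \<and>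
        game_value (parallel_repetition n G) \<ge>
          exp (- C * real n *
            ((log 2 (log 2 (real (card (answer_set G))))) powr (1 / real l) /
             log 2 (real (card (answer_set G)))))))"
proof -
  have "(2::nat) ^ 1 \<le> 2 ^ (l - 1)" using assms(1) by (intro power_increasing) auto
  then have r: "r \<ge> 3" using assms(2) by simp
  obtain h where h: "l = Suc h" using assms(1) by (cases l) auto
  \<comment> \<open>Starting from \<open>D = 1\<close>, the \<open>l - 1\<close> squarings reach
    degree \<open>2 ^ (l - 1)\<close>; \<open>r\<close> is the least progression length exceeding
    it.\<close>
  have "1 * 2 ^ h < r" using assms(2) h by simp
  from rankin_prog_free[OF this] obtain c where c: "\<And>m. m \<ge> 1 \<Longrightarrow>
      \<exists>A. A \<subseteq> {0..<2 ^ (m ^ l)} \<and> prog_free r 1 A \<and> 2 ^ (m ^ l) \<le> card A * 2 ^ (c * m)"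
    unfolding h by blast
  show ?thesis
  proof (intro exI[of _ "real (4 * r * (c + 1))"] conjI allI impI)
    show "0 < real (4 * r * (c + 1))" using r unfolding of_nat_0_less_iff by simp
    fix n :: nat
    assume n: "2 \<le> n"
    have "r * n \<ge> 2" using mult_le_mono[of 1 r 2 n] r n by simp
    then obtain m where m: "m \<ge> 1" "r * n \<le> 2 ^ (m ^ l)"
      "real m \<le> 2 * log 2 (real (r * n)) powr (1 / real l)"
      using exists_root_exponent[of "r * n" l] assms(1) by auto
    obtain A where A: "A \<subseteq> {0..<2 ^ (m ^ l)}" "prog_free r 1 A" "2 ^ (m ^ l) \<le> card A * 2 ^ (c * m)"
      using c[OF m(1)] by blast
    define T where "T = ({..<n} \<rightarrow>\<^sub>E {0, 1::nat}) \<times> {..<n}"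
    have "finite T" "card T = n * 2 ^ n"
      by (auto simp: T_def card_cartesian_product card_PiE finite_PiE numeral_2_eq_2)
    then obtain enc where enc: "bij_betw enc T {..<n * 2 ^ n}"
      using ex_bij_betw_finite_nat[of T] by (auto simp: atLeast0LessThan)
    define dec where "dec = inv_into T enc"
    have enc_in: "enc \<in> T \<rightarrow> {..<n * 2 ^ n}" using enc by (auto simp: bij_betw_def)
    have dec_enc: "dec (enc x) = x" if "x \<in> T" for x
      using enc that by (simp add: dec_def bij_betw_def)
    have dec_in: "dec \<in> {..<n * 2 ^ n} \<rightarrow> T"
      using bij_betw_inv_into[OF enc] by (auto simp: bij_betw_def dec_def)
    define Q where "Q = question_set (parallel_repetition n (coordinate_game r n A dec))"
    \<comment> \<open>The questions do not depend on the set, so the translate may be chosen after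
      \<open>Q\<close> is fixed.\<close>
    have Q_eq: "question_set (parallel_repetition n (coordinate_game r n A' dec)) = Q" for A'
      by (simp add: Q_def parallel_repetition_def coordinate_game_def)
    have fQ: "finite Q"
    proof (rule finite_subset)
      show "Q \<subseteq> {..<r} \<rightarrow>\<^sub>E ({..<n} \<rightarrow>\<^sub>E {0, 1})"
        by (auto simp: Q_def parallel_repetition_def coordinate_game_def)
    qed (intro finite_PiE, auto intro!: finite_PiE)
    have Qne: "Q \<noteq> {}"
    proof -
      define q where "q = (\<lambda>j\<in>{..<r}. \<lambda>i\<in>{..<n}. if j = 0 then 1 else (0::nat))"
      have "coord r q i = (\<lambda>j\<in>{..<r}. if j = 0 then 1 else 0)" if "i < n" for i
        using that by (auto simp: coord_def q_def)
      then have "coord r q i \<in> one_hot_questions r" if "i < n" for i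
        using that r unfolding one_hot_questions_eq by (intro image_eqI[of _ _ 0]) auto
      then have "q \<in> Q"
        by (auto simp: Q_def parallel_repetition_def coordinate_game_def q_def restrict_PiE_iff)
      then show ?thesis by blast
    qed
    define N :: nat where "N = 2 ^ (m ^ l)"
    have bounds: "0 \<le> weighted_count r n q \<and> weighted_count r n q < int N" if "q \<in> Q" for q
    proof -
      have "int (r * n) \<le> int N" using m(2) unfolding N_def by (simp only: of_nat_le_iff)
      then show ?thesis using weighted_count_bounds[OF that[unfolded Q_def]] r n by auto
    qed
    have sub: "A \<subseteq> {0..<int N}" using A(1) by (simp add: N_def)
    \<comment> \<open>All weighted counts lie below \<open>r * n\<close>, hence below
      \<open>N\<close>, so some translate captures a fraction of \<open>Q\<close> at least half the
      density of \<open>A\<close>.\<close>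
    obtain t where t: "card Q * card A \<le> card {q \<in> Q. weighted_count r n q + t \<in> A} * (2 * N)"
      using exists_translate_many[of Q "weighted_count r n", OF fQ bounds sub] ..
    define A' where "A' = {a. a + t \<in> A}"
    define G where "G = coordinate_game r n A' dec"
    define W where "W = {q \<in> Q. weighted_count r n q \<in> A'}"
    have "card Q * card A \<le> card W * (2 * N)" using t by (simp add: W_def A'_def)
    also have "\<dots> \<le> card W * (2 * (card A * 2 ^ (c * m)))"
      using A(3) by (intro mult_le_mono) (auto simp: N_def)
    finally have "card A * card Q \<le> card A * (card W * 2 ^ (c * m + 1))" by (simp add: mult_ac)
    moreover have "card A > 0" using A(3) by (cases "card A = 0") auto
    ultimately have "card Q \<le> card W * 2 ^ (c * m + 1)" by simp
    then have "real (card Q) \<le> real (card W * 2 ^ (c * m + 1))" by (simp only: of_nat_le_iff)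
    then have "1 / 2 ^ (c * m + 1) \<le> real (card W) / real (card Q)"
      using Qne fQ by (simp add: field_simps card_gt_0_iff)
    also have "\<dots> \<le> game_value (parallel_repetition n G)"
      using coordinate_game_repetition_value_ge[OF enc_in[unfolded T_def], of dec r A'] dec_enc
      unfolding Q_eq W_def G_def T_def by blast
    finally have val: "1 / 2 ^ (c * m + 1) \<le> game_value (parallel_repetition n G)" .
    have card: "card (answer_set G) = (n * 2 ^ n) ^ r"
      by (simp add: answer_set_def G_def coordinate_game_def card_PiE)
    have lower: "2 ^ (r * n) \<le> card (answer_set G)"
    proof -
      have "(2 ^ n) ^ r \<le> (n * 2 ^ n) ^ r" using n by (intro power_mono) auto
      then show ?thesis unfolding card by (simp add: mult.commute flip: power_mult)
    qed
    have upper: "card (answer_set G) \<le> 2 ^ (2 * r * n)"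
    proof -
      \<comment> \<open>Naming a coordinate at most doubles the bit length of an answer.\<close>
      have "n * 2 ^ n \<le> 2 ^ n * 2 ^ n" by (intro mult_le_mono less_imp_le less_exp) auto
      then have "(n * 2 ^ n) ^ r \<le> (2 ^ (2 * n)) ^ r"
        by (intro power_mono) (auto simp: mult_2 power_add)
      then show ?thesis unfolding card by (simp add: mult_ac flip: power_mult)
    qed
    have value_le: "game_value G \<le> 1 - 1 / real r"
      unfolding G_def A'_def using r n A(2) dec_in
      by (intro coordinate_game_value_le prog_free_translate) (auto simp: T_def)
    have game: "is_game G"
      using r n is_question_set_one_hot[of r]
      by (auto simp: is_game_def G_def coordinate_game_def lessThan_empty_iff)
    have "exp (- real (4 * r * (c + 1)) * real n *
        (log 2 (log 2 (real (card (answer_set G)))) powr (1 / real l) / log 2 (real (card (answer_set G)))))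
        \<le> 1 / 2 ^ (c * m + 1)"
      using r by (intro exp_loglog_bound n m lower upper) simp
    also note val
    finally show "\<exists>G :: (nat, nat) game.
        is_game G \<and> provers G = r \<and> (\<forall>j<r. question_alphabet G j = {0, 1}) \<and>
        question_set G = one_hot_questions r \<and> game_value G \<le> 1 - 1 / real r \<and>
        2 ^ (r * n) \<le> card (answer_set G) \<and> card (answer_set G) \<le> 2 ^ (2 * r * n) \<and>
        game_value (parallel_repetition n G) \<ge> exp (- real (4 * r * (c + 1)) * real n *
          ((log 2 (log 2 (real (card (answer_set G))))) powr (1 / real l) /
             log 2 (real (card (answer_set G)))))"
    proof (intro exI[of _ G] conjI game value_le lower upper)
      show "provers G = r" "question_set G = one_hot_questions r"
        "\<forall>j<r. question_alphabet G j = {0, 1}"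
        by (simp_all add: G_def coordinate_game_def)
    qed
  qed
qed

end
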